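(* Let $D_n$ be the dihedral group of order $2n$. Then: (i) if $n=p^r$ for some prime $p$, the difference graph $D(D_n)$ is the empty graph; (ii) if $n$ is not a prime power, $D(D_n)$ is a connected graph.
   Context: For a group $G$, the power graph $\mathsf{Pow}(G)$ has vertex set $G$, with distinct $a,b$ adjacent iff $a\in\langle b\rangle$ or $b\in\langle a\rangle$. The enhanced power graph $\mathsf{EPow}(G)$ has vertex set $G$, with distinct $a,b$ adjacent iff $\langle a,b\rangle$ is cyclic. The difference graph $D(G)$ is the graph $\mathsf{EPow}(G)-\mathsf{Pow}(G)$ with all isolated vertices removed; thus $x\sim y$ in $D(G)$ iff $\langle x,y\rangle$ is cyclic, $x\notin\langle y\rangle$ and $y\notin\langle x\rangle$. *)

theory Defs
  imports
    "HOL-Algebra.Elementary_Groups"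
    "HOL-Computational_Algebra.Primes"
    "Graph_Theory.Digraph_Component"
begin

text \<open>
  Simple graphs are represented, as in \<open>Graph_Theory\<close>, by symmetric loop-free digraphs whose arcs
  are pairs of vertices; an edge is a pair of opposite arcs.
\<close>

definition power_graph :: "('a, 'm) monoid_scheme \<Rightarrow> 'a pair_pre_digraph" where
  "power_graph G =
     \<lparr> pverts = carrier G,
       parcs = {(a, b). a \<in> carrier G \<and> b \<in> carrier G \<and> a \<noteq> b \<and>
                        (a \<in> generate G {b} \<or> b \<in> generate G {a})} \<rparr>"

definition enhanced_power_graph :: "('a, 'm) monoid_scheme \<Rightarrow> 'a pair_pre_digraph" where
  "enhanced_power_graph G =
     \<lparr> pverts = carrier G,
       parcs = {(a, b). a \<in> carrier G \<and> b \<in> carrier G \<and> a \<noteq> b \<and>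
                        cyclic_group (subgroup_generated G {a, b})} \<rparr>"

definition remove_edges :: "'a pair_pre_digraph \<Rightarrow> 'a pair_pre_digraph \<Rightarrow> 'a pair_pre_digraph" where
  "remove_edges \<Gamma> \<Delta> = \<lparr> pverts = pverts \<Gamma>, parcs = parcs \<Gamma> - parcs \<Delta> \<rparr>"

definition remove_isolated :: "'a pair_pre_digraph \<Rightarrow> 'a pair_pre_digraph" where
  "remove_isolated \<Gamma> =
     \<lparr> pverts = {v \<in> pverts \<Gamma>. \<exists>w. (v, w) \<in> parcs \<Gamma> \<or> (w, v) \<in> parcs \<Gamma>}, parcs = parcs \<Gamma> \<rparr>"

definition difference_graph :: "('a, 'm) monoid_scheme \<Rightarrow> 'a pair_pre_digraph" where
  "difference_graph G = remove_isolated (remove_edges (enhanced_power_graph G) (power_graph G))"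

text \<open>
  The dihedral group of order \<open>2n\<close> (for \<open>n > 0\<close>), as the semidirect product of the integers modulo
  \<open>n\<close> with a group of order 2 acting by negation: \<open>(i, b)\<close> stands for \<open>r\<^sup>i\<close> if \<open>b\<close> is
  \<open>False\<close> and for \<open>r\<^sup>i s\<close> if \<open>b\<close> is \<open>True\<close>, where \<open>r\<close> is the rotation of order \<open>n\<close> and
  \<open>s\<close> is a reflection.
\<close>

definition dihedral_group :: "nat \<Rightarrow> (int \<times> bool) monoid" where
  "dihedral_group n =
     \<lparr> carrier = {0..<int n} \<times> UNIV,
       monoid.mult = (\<lambda>(i, a) (j, b). ((if a then i - j else i + j) mod int n, a \<noteq> b)),
       one = (0, False) \<rparr>"

lemma parcs_difference_graph:
  "(x, y) \<in> parcs (difference_graph G) \<longleftrightarrow>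
     x \<in> carrier G \<and> y \<in> carrier G \<and> x \<noteq> y \<and> cyclic_group (subgroup_generated G {x, y}) \<and>
     x \<notin> generate G {y} \<and> y \<notin> generate G {x}"
  by (auto simp: difference_graph_def remove_isolated_def remove_edges_def
      enhanced_power_graph_def power_graph_def)

lemma pverts_difference_graph:
  "x \<in> pverts (difference_graph G) \<longleftrightarrow> (\<exists>y. (x, y) \<in> parcs (difference_graph G))"
  by (auto simp: difference_graph_def remove_isolated_def remove_edges_def
      enhanced_power_graph_def power_graph_def insert_commute)

lemma difference_graph_simple: "pair_bidirected_digraph (difference_graph G)"
proof
  fix e assume e: "e \<in> parcs (difference_graph G)"
  obtain x y where xy: "e = (x, y)" by (cases e)
  with e have "(x, y) \<in> parcs (difference_graph G)" "(y, x) \<in> parcs (difference_graph G)"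
    by (auto simp: parcs_difference_graph insert_commute)
  with xy show "fst e \<in> pverts (difference_graph G)" "snd e \<in> pverts (difference_graph G)"
    by (auto simp: pverts_difference_graph)
  from e xy show "fst e \<noteq> snd e" by (auto simp: parcs_difference_graph)
next
  show "symmetric (with_proj (difference_graph G))"
    by (auto simp: symmetric_def sym_def parcs_difference_graph insert_commute)
qed

lemma dihedral_group_simps:
  "carrier (dihedral_group n) = {0..<int n} \<times> UNIV"
  "(i, a) \<otimes>\<^bsub>dihedral_group n\<^esub> (j, b) = ((if a then i - j else i + j) mod int n, a \<noteq> b)"
  "\<one>\<^bsub>dihedral_group n\<^esub> = (0, False)"
  by (simp_all add: dihedral_group_def)

lemma group_dihedral_group:
  assumes "n > 0" shows "group (dihedral_group n)"
proof (rule groupI)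
  fix x y assume "x \<in> carrier (dihedral_group n)" "y \<in> carrier (dihedral_group n)"
  then show "x \<otimes>\<^bsub>dihedral_group n\<^esub> y \<in> carrier (dihedral_group n)"
    using assms by (cases x; cases y) (auto simp: dihedral_group_simps)
next
  show "\<one>\<^bsub>dihedral_group n\<^esub> \<in> carrier (dihedral_group n)"
    using assms by (auto simp: dihedral_group_simps)
next
  fix x y z
  show "x \<otimes>\<^bsub>dihedral_group n\<^esub> y \<otimes>\<^bsub>dihedral_group n\<^esub> z =
        x \<otimes>\<^bsub>dihedral_group n\<^esub> (y \<otimes>\<^bsub>dihedral_group n\<^esub> z)"
    by (cases x; cases y; cases z) (auto simp: dihedral_group_simps mod_simps algebra_simps)
next
  fix x assume "x \<in> carrier (dihedral_group n)"
  then show "\<one>\<^bsub>dihedral_group n\<^esub> \<otimes>\<^bsub>dihedral_group n\<^esub> x = x"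
    by (cases x) (auto simp: dihedral_group_simps)
next
  fix x assume "x \<in> carrier (dihedral_group n)"
  moreover obtain i a where "x = (i, a)" by (cases x)
  ultimately show "\<exists>y\<in>carrier (dihedral_group n). y \<otimes>\<^bsub>dihedral_group n\<^esub> x = \<one>\<^bsub>dihedral_group n\<^esub>"
    using assms
    by (intro bexI[of _ "((if a then i else - i) mod int n, a)"])
       (auto simp: dihedral_group_simps mod_simps)
qed

lemma order_dihedral_group: "order (dihedral_group n) = 2 * n"
  by (simp add: order_def dihedral_group_simps card_cartesian_product)

lemma dihedral_group_rotation_power:
  "(1 mod int n, False) [^]\<^bsub>dihedral_group n\<^esub> (k::nat) = (int k mod int n, False)"
  by (induction k) (simp_all add: nat_pow_def dihedral_group_simps mod_simps add.commute)

lemma dihedral_group_relations: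
  fixes n :: nat
  defines "D \<equiv> dihedral_group n" and "r \<equiv> (1 mod int n, False)" and "s \<equiv> (0, True)"
  shows "r [^]\<^bsub>D\<^esub> n = \<one>\<^bsub>D\<^esub>" and "s \<otimes>\<^bsub>D\<^esub> s = \<one>\<^bsub>D\<^esub>"
    and "(s \<otimes>\<^bsub>D\<^esub> r \<otimes>\<^bsub>D\<^esub> s) \<otimes>\<^bsub>D\<^esub> r = \<one>\<^bsub>D\<^esub>"
  unfolding D_def r_def s_def
  by (simp_all add: dihedral_group_rotation_power dihedral_group_simps mod_simps)

lemma generate_dihedral_group:
  assumes "n > 0"
  shows "generate (dihedral_group n) {(1 mod int n, False), (0, True)} = carrier (dihedral_group n)"
    (is "generate ?D ?S = _")
proof
  interpret group ?D using assms by (rule group_dihedral_group)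
  have S: "?S \<subseteq> carrier ?D" using assms by (auto simp: dihedral_group_simps)
  then show "generate ?D ?S \<subseteq> carrier ?D" by (rule generate_incl)
  show "carrier ?D \<subseteq> generate ?D ?S"
  proof
    fix x assume "x \<in> carrier ?D"
    then obtain i a where x: "x = (i, a)" "0 \<le> i" "i < int n"
      by (cases x) (auto simp: dihedral_group_simps)
    have pow: "(1 mod int n, False) [^]\<^bsub>?D\<^esub> k \<in> generate ?D ?S" for k :: nat
    proof (induction k)
      case 0
      then show ?case by (simp add: generate.one)
    next
      case (Suc k)
      then show ?case by (simp add: generate.eng generate.incl)
    qed
    from pow[of "nat i"] x have rot: "(i, False) \<in> generate ?D ?S"
      by (simp add: dihedral_group_rotation_power)
    have "(i, False) \<otimes>\<^bsub>?D\<^esub> (0, True) \<in> generate ?D ?S"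
      using rot by (rule generate.eng) (simp add: generate.incl)
    with x rot show "x \<in> generate ?D ?S" by (cases a) (auto simp: dihedral_group_simps)
  qed
qed

end

theory Submission
  imports Defs
begin

text \<open>
  A cyclic subgroup containing a reflection is generated by that reflection, so the edges of the
  difference graph join rotations. The rotations by \<open>i\<close> and \<open>j\<close> are adjacent iff \<open>gcd i n\<close> and
  \<open>gcd j n\<close> are incomparable under divisibility. If \<open>n\<close> is a prime power, its divisors form a chain.
  Otherwise, for every prime \<open>q\<close> dividing \<open>n\<close> let \<open>Q\<close> be the largest power of \<open>q\<close> dividing \<open>n\<close>. The
  rotations by these \<open>Q\<close> are pairwise adjacent, and every other non-isolated rotation is adjacent
  to one of them.
\<close>

text \<open>Turns cyclicity, which refers to powers inside \<open>subgroup_generated G S\<close>,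
  into an equation between subgroups of \<open>G\<close>; powers agree in both groups.\<close>

lemma (in group) cyclic_group_subgroup_generated_iff:
  assumes "S \<subseteq> carrier G"
  shows "cyclic_group (subgroup_generated G S) \<longleftrightarrow>
    (\<exists>g\<in>carrier G. generate G S = generate G {g})" (is "?L \<longleftrightarrow> ?R")
proof
  let ?H = "subgroup_generated G S"
  have carrier_H: "carrier ?H = generate G S"
    using assms by (simp add: carrier_subgroup_generated Int_absorb1)
  interpret H: group ?H by simp
  assume ?L
  then obtain g where g: "g \<in> carrier ?H" "carrier ?H = range (\<lambda>k::int. g [^]\<^bsub>?H\<^esub> k)"
    using H.cyclic_group by blast
  have g_carrier: "g \<in> carrier G"
    using g(1) carrier_H generate_incl[OF assms] by auto
  moreover have "generate G S = generate G {g}"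
    using g(2) unfolding carrier_H generate_pow[OF g_carrier] int_pow_subgroup_generated[OF g(1)]
    by (simp add: full_SetCompr_eq)
  ultimately show ?R by blast
next
  assume ?R
  then obtain g where "g \<in> carrier G" "generate G S = generate G {g}" by blast
  then have "subgroup_generated G S = subgroup_generated G {g}"
    using assms by (simp add: subgroup_generated_def Int_absorb1)
  then show ?L by (simp add: cyclic_group_generated)
qed

lemma dihedral_group_rotation_nat_pow:
  "(i, False) [^]\<^bsub>dihedral_group n\<^esub> (k::nat) = (int k * i mod int n, False)"
  by (induction k) (simp_all add: nat_pow_def dihedral_group_simps mod_simps algebra_simps)

lemma dihedral_group_rotation_int_pow:
  assumes "0 \<le> i" "i < int n"
  shows "(i, False) [^]\<^bsub>dihedral_group n\<^esub> (k::int) = (k * i mod int n, False)"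
proof (cases "k < 0")
  case True
  interpret group "dihedral_group n" using assms by (intro group_dihedral_group) simp
  have "inv\<^bsub>dihedral_group n\<^esub> (- k * i mod int n, False) = (k * i mod int n, False)"
    using assms by (intro inv_equality) (auto simp: dihedral_group_simps mod_simps)
  with True show ?thesis
    by (simp add: int_pow_def2 dihedral_group_rotation_nat_pow)
next
  case False
  then show ?thesis by (simp add: int_pow_def2 dihedral_group_rotation_nat_pow)
qed

text \<open>By Bezout, the multiples of \<open>j\<close> modulo \<open>n\<close> are exactly the
  residues divisible by \<open>gcd j n\<close>.\<close>

lemma generate_rotation:
  assumes "j < n" "i < n"
  shows "(int i, False) \<in> generate (dihedral_group n) {(int j, False)} \<longleftrightarrow> gcd j n dvd i"
proof -
  interpret group "dihedral_group n" using assms by (intro group_dihedral_group) simp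
  have "(int i, False) \<in> generate (dihedral_group n) {(int j, False)} \<longleftrightarrow>
      (\<exists>k. int i = k * int j mod int n)"
    using assms
    by (subst generate_pow) (auto simp: dihedral_group_simps dihedral_group_rotation_int_pow)
  also have "\<dots> \<longleftrightarrow> gcd (int j) (int n) dvd int i"
  proof
    assume "\<exists>k. int i = k * int j mod int n"
    then obtain k where k: "int i = k * int j mod int n" ..
    show "gcd (int j) (int n) dvd int i" unfolding k by (rule dvd_mod) auto
  next
    assume "gcd (int j) (int n) dvd int i"
    then obtain c where c: "int i = gcd (int j) (int n) * c" ..
    obtain u v where uv: "u * int j + v * int n = gcd (int j) (int n)"
      using bezout_int by blast
    have "int i = (u * c) * int j + (v * c) * int n"
      unfolding c uv[symmetric] by (simp add: algebra_simps)
    then have "int i mod int n = (u * c) * int j mod int n"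
      by (metis mod_mult_self1)
    then show "\<exists>k. int i = k * int j mod int n" using assms by (metis mod_less zmod_int)
  qed
  also have "\<dots> \<longleftrightarrow> gcd j n dvd i" by simp
  finally show ?thesis .
qed

text \<open>A reflection is an involution, so together with the identity it already forms a
  subgroup.\<close>

lemma generate_reflection:
  assumes "0 \<le> i" "i < int n"
  shows "generate (dihedral_group n) {(i, True)} = {\<one>\<^bsub>dihedral_group n\<^esub>, (i, True)}"
proof
  let ?D = "dihedral_group n"
  interpret group ?D using assms by (intro group_dihedral_group) simp
  have car: "(i, True) \<in> carrier ?D" using assms by (simp add: dihedral_group_simps)
  have sq: "(i, True) \<otimes>\<^bsub>?D\<^esub> (i, True) = \<one>\<^bsub>?D\<^esub>" by (simp add: dihedral_group_simps)
  have "subgroup {\<one>\<^bsub>?D\<^esub>, (i, True)} ?D"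
    using car sq inv_equality[OF sq car car] by (intro subgroupI) auto
  then show "generate ?D {(i, True)} \<subseteq> {\<one>\<^bsub>?D\<^esub>, (i, True)}"
    by (rule generate_subgroup_incl[rotated]) simp
  show "{\<one>\<^bsub>?D\<^esub>, (i, True)} \<subseteq> generate ?D {(i, True)}"
    by (auto intro: generate.one generate.incl)
qed

text \<open>Bezout coefficients write the rotation by \<open>gcd i j\<close> as a product of powers
  of the two rotations, and both are powers of it. Hence cyclicity is automatic for two
  rotations.\<close>

lemma generate_rotations:
  assumes "i < n" "j < n"
  shows "generate (dihedral_group n) {(int i, False), (int j, False)} =
    generate (dihedral_group n) {(int (gcd i j), False)}" (is "generate ?D {?x, ?y} = generate ?D {?g}")
proof
  interpret group ?D using assms by (intro group_dihedral_group) simp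
  \<comment> \<open>For \<open>i = 0\<close> the gcd is \<open>j\<close>; otherwise it is at most
    \<open>i\<close>.\<close>
  have less: "gcd i j < n" using assms by (metis gcd_le1_nat gcd_0_left_nat le_less_trans)
  have car: "?x \<in> carrier ?D" "?y \<in> carrier ?D" "?g \<in> carrier ?D"
    using assms less by (auto simp: dihedral_group_simps)
  have "?x \<in> generate ?D {?g}" "?y \<in> generate ?D {?g}"
    using assms less by (auto simp: generate_rotation intro: dvd_trans[OF gcd_dvd1])
  then show "generate ?D {?x, ?y} \<subseteq> generate ?D {?g}"
    using car by (intro generate_subgroup_incl generate_is_subgroup) auto
  have sub: "subgroup (generate ?D {?x, ?y}) ?D"
    using car by (intro generate_is_subgroup) auto
  obtain u v where uv: "u * int i + v * int j = gcd (int i) (int j)"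
    using bezout_int by blast
  have "?x [^]\<^bsub>?D\<^esub> u \<otimes>\<^bsub>?D\<^esub> ?y [^]\<^bsub>?D\<^esub> v = (gcd (int i) (int j) mod int n, False)"
    using assms by (simp add: dihedral_group_rotation_int_pow dihedral_group_simps mod_simps uv)
  also have "\<dots> = ?g" using less by simp
  finally have "?g = ?x [^]\<^bsub>?D\<^esub> u \<otimes>\<^bsub>?D\<^esub> ?y [^]\<^bsub>?D\<^esub> v" ..
  also have "\<dots> \<in> generate ?D {?x, ?y}"
    using sub by (intro generate.eng subgroup_int_pow_closed) (auto intro: generate.incl)
  finally show "generate ?D {?g} \<subseteq> generate ?D {?x, ?y}"
    using sub by (intro generate_subgroup_incl) auto
qed

text \<open>Makes adjacency arithmetic: only the two non-membership conditions remain between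
  rotations, and \<open>generate_rotation\<close> translates them.\<close>

lemma parcs_difference_graph_dihedral_group:
  assumes "n > 0"
  shows "(x, y) \<in> parcs (difference_graph (dihedral_group n)) \<longleftrightarrow>
    (\<exists>i j. x = (int i, False) \<and> y = (int j, False) \<and> i < n \<and> j < n \<and>
           \<not> gcd i n dvd j \<and> \<not> gcd j n dvd i)" (is "?L \<longleftrightarrow> ?R")
proof
  let ?D = "dihedral_group n"
  interpret group ?D using assms by (rule group_dihedral_group)
  assume ?L
  then have car: "x \<in> carrier ?D" "y \<in> carrier ?D"
    and cyc: "cyclic_group (subgroup_generated ?D {x, y})"
    and x: "x \<notin> generate ?D {y}" and y: "y \<notin> generate ?D {x}"
    by (auto simp: parcs_difference_graph)
  from cyc car obtain g where g: "g \<in> carrier ?D" "generate ?D {x, y} = generate ?D {g}"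
    by (auto simp: cyclic_group_subgroup_generated_iff)
  have mem: "x \<in> generate ?D {g}" "y \<in> generate ?D {g}"
    unfolding g(2)[symmetric] by (auto intro: generate.incl)
  \<comment> \<open>If \<open>g\<close> were a reflection, \<open>x\<close> and \<open>y\<close>
    would lie in a group of order 2, where one of any two elements lies in the subgroup generated by
    the other.\<close>
  have "\<not> snd g"
  proof
    assume "snd g"
    with g have "generate ?D {g} = {\<one>\<^bsub>?D\<^esub>, g}"
      by (cases g) (simp add: generate_reflection dihedral_group_simps)
    with mem x y show False by (auto intro: generate.one generate.incl)
  qed
  then have "\<not> snd z" if "z \<in> generate ?D {g}" for z
    using that g by (cases g)
      (auto simp: generate_pow dihedral_group_rotation_int_pow dihedral_group_simps)
  with mem have "\<not> snd x" "\<not> snd y" by auto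
  with car obtain i j where "x = (int i, False)" "y = (int j, False)" "i < n" "j < n"
    by (cases x; cases y) (auto simp: dihedral_group_simps elim!: nonneg_int_cases)
  with x y show ?R by (auto simp: generate_rotation)
next
  let ?D = "dihedral_group n"
  interpret group ?D using assms by (rule group_dihedral_group)
  assume ?R
  then obtain i j where ij: "x = (int i, False)" "y = (int j, False)" "i < n" "j < n"
    "\<not> gcd i n dvd j" "\<not> gcd j n dvd i" by blast
  have car: "x \<in> carrier ?D" "y \<in> carrier ?D" using ij by (auto simp: dihedral_group_simps)
  have "gcd i j < n" using ij by (metis gcd_le1_nat gcd_0_left_nat le_less_trans)
  then have "\<exists>g\<in>carrier ?D. generate ?D {x, y} = generate ?D {g}"
    using generate_rotations[of i n j] ij by (force simp: dihedral_group_simps)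
  then have "cyclic_group (subgroup_generated ?D {x, y})"
    using car by (simp add: cyclic_group_subgroup_generated_iff)
  with car ij show ?L by (auto simp: parcs_difference_graph generate_rotation)
qed

text \<open>Some prime \<open>q\<close> has a smaller exponent in \<open>gcd a n\<close> than in
  \<open>gcd b n\<close>, hence than in \<open>n\<close>. For this \<open>q\<close>, the rotation by
  the full \<open>q\<close>-part of \<open>n\<close> will be a neighbour of the rotation by
  \<open>a\<close>.\<close>

lemma not_dvd_prime_power_multiplicity:
  fixes a b n :: nat
  assumes "n > 0" and ab: "\<not> gcd a n dvd b" and ba: "\<not> gcd b n dvd a"
  obtains q where "prime q" "q dvd n" "\<not> gcd a n dvd q ^ multiplicity q n"
    "\<not> q ^ multiplicity q n dvd a"
proof -
  have "\<not> gcd b n dvd gcd a n" using ba by simp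
  then obtain q where q: "prime q" and lt: "multiplicity q (gcd a n) < multiplicity q (gcd b n)"
    using multiplicity_le_imp_dvd[of "gcd b n" "gcd a n"] \<open>n > 0\<close>
    by (metis gcd_eq_0_iff not_le not_gr0)
  have le: "multiplicity q (gcd b n) \<le> multiplicity q n"
    using \<open>n > 0\<close> by (intro dvd_imp_multiplicity_le) auto
  have "multiplicity q n > 0" using lt le by linarith
  then have "q dvd n" by (metis not_dvd_imp_multiplicity_0 less_irrefl)
  moreover have "\<not> q ^ multiplicity q n dvd a"
  proof
    assume "q ^ multiplicity q n dvd a"
    then have "q ^ multiplicity q n dvd gcd a n" by (simp add: multiplicity_dvd)
    then have "multiplicity q n \<le> multiplicity q (gcd a n)"
      using q \<open>n > 0\<close> by (intro multiplicity_geI) auto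
    with lt le show False by simp
  qed
  \<comment> \<open>Otherwise \<open>gcd a n\<close> is a pure power of \<open>q\<close> with
    exponent below that in \<open>gcd b n\<close>, so it divides \<open>b\<close>, against
    \<open>ab\<close>.\<close>
  moreover have "\<not> gcd a n dvd q ^ multiplicity q n"
  proof
    assume "gcd a n dvd q ^ multiplicity q n"
    then obtain k where k: "gcd a n = q ^ k" using q by (auto simp: divides_primepow_nat)
    then have "multiplicity q (gcd a n) = k" using q by (simp add: multiplicity_same_power)
    then have "q ^ k dvd gcd b n"
      using lt by (intro multiplicity_dvd') simp
    then have "gcd a n dvd gcd b n" by (simp only: k)
    with ab show False by simp
  qed
  ultimately show thesis using q that by blast
qed

theorem theorem3p5:
  fixes n :: nat
  assumes "n \<ge> 1"
  shows "(\<forall>p r :: nat. prime p \<and> n = p ^ r \<longrightarrow>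
            pverts (difference_graph (dihedral_group n)) = {} \<and>
            parcs (difference_graph (dihedral_group n)) = {})
       \<and> ((\<nexists>p r :: nat. prime p \<and> n = p ^ r) \<longrightarrow>
            Digraph_Component.connected (with_proj (difference_graph (dihedral_group n))))"
proof (intro conjI allI impI)
  fix p r :: nat
  assume pr: "prime p \<and> n = p ^ r"
  have "gcd i n dvd j \<or> gcd j n dvd i" for i j
  proof -
    have "gcd i n dvd p ^ r" "gcd j n dvd p ^ r" using pr by auto
    then obtain k l where "gcd i n = p ^ k" "gcd j n = p ^ l"
      using pr by (meson divides_primepow_nat)
    then have "gcd i n dvd gcd j n \<or> gcd j n dvd gcd i n"
      by (metis le_imp_power_dvd linear)
    then show ?thesis by simp
  qed
  then have *: "(x, y) \<notin> parcs (difference_graph (dihedral_group n))" for x y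
    using assms by (auto simp: parcs_difference_graph_dihedral_group)
  then show "parcs (difference_graph (dihedral_group n)) = {}" by auto
  show "pverts (difference_graph (dihedral_group n)) = {}"
    using * by (auto simp: pverts_difference_graph)
next
  assume npp: "\<nexists>p r :: nat. prime p \<and> n = p ^ r"
  let ?\<Gamma> = "difference_graph (dihedral_group n)"
  define Q where "Q q = q ^ multiplicity q n" for q
  define hub where "hub q = (int (Q q), False)" for q
  have Q_dvd: "Q q dvd n" for q by (simp add: Q_def multiplicity_dvd)
  \<comment> \<open>Equality would make \<open>n\<close> a prime power. Strictness puts
    \<open>hub q\<close> into the carrier.\<close>
  have Q_less: "Q q < n" if "prime q" for q
    using npp that Q_dvd[of q] assms unfolding Q_def
    by (metis dvd_imp_le le_neq_implies_less less_eq_Suc_le One_nat_def)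
  have gcd_Q: "gcd (Q q) n = Q q" for q using Q_dvd by (simp add: gcd_nat.absorb1)
  interpret pair_bidirected_digraph ?\<Gamma> by (rule difference_graph_simple)
  have hubs_adjacent: "(hub q, hub q') \<in> parcs ?\<Gamma>"
    if "prime q" "q dvd n" "prime q'" "q' dvd n" "q \<noteq> q'" for q q'
  proof -
    \<comment> \<open>Proved for arbitrary \<open>q\<close> and \<open>q'\<close> because adjacency
      needs it in both orders.\<close>
    have "\<not> Q q dvd Q q'" if "prime q" "q dvd n" "prime q'" "q \<noteq> q'" for q q'
    proof
      assume "Q q dvd Q q'"
      moreover have "q dvd Q q"
        using that assms unfolding Q_def by (simp add: prime_multiplicity_gt_zero_iff)
      ultimately have "q dvd q'"
        using that unfolding Q_def[of q'] by (meson dvd_trans prime_dvd_power)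
      with that show False by (simp add: primes_dvd_imp_eq)
    qed
    with that show ?thesis
      using assms Q_less by (auto simp: parcs_difference_graph_dihedral_group hub_def gcd_Q)
  qed
  have adjacent_hub: "\<exists>q. prime q \<and> q dvd n \<and> (v, hub q) \<in> parcs ?\<Gamma>" if v: "v \<in> pverts ?\<Gamma>" for v
  proof -
    obtain w where "(v, w) \<in> parcs ?\<Gamma>" using v by (auto simp: pverts_difference_graph)
    then obtain i j where ij: "v = (int i, False)" "i < n" "\<not> gcd i n dvd j" "\<not> gcd j n dvd i"
      using assms by (auto simp: parcs_difference_graph_dihedral_group)
    obtain q where q: "prime q" "q dvd n" "\<not> gcd i n dvd Q q" "\<not> Q q dvd i"
      using not_dvd_prime_power_multiplicity[OF _ ij(3,4)] assms unfolding Q_def by auto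
    then show ?thesis
      using ij assms Q_less by (auto simp: parcs_difference_graph_dihedral_group hub_def gcd_Q)
  qed
  have sym: "(y, x) \<in> parcs ?\<Gamma>" if "(x, y) \<in> parcs ?\<Gamma>" for x y
    using that by (auto simp: parcs_difference_graph insert_commute)
  \<comment> \<open>Connectedness includes having a vertex, so two distinct primes dividing
    \<open>n\<close> are needed. A first one exists since \<open>npp\<close> excludes
    \<open>1 = 2 ^ 0\<close>.\<close>
  obtain p where p: "prime p" "p dvd n"
    using npp assms by (metis prime_factor_nat power_0 two_is_prime_nat)
  \<comment> \<open>The second prime comes from the cofactor \<open>m\<close>, which differs from 1
    and from which \<open>p\<close> is divided out completely.\<close>
  obtain m where m: "n = Q p * m" using Q_dvd by blast
  then have "m \<noteq> 1" using Q_less[OF p(1)] by auto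
  then obtain p' where p': "prime p'" "p' dvd m" by (metis prime_factor_nat)
  have "\<not> p dvd m"
    using multiplicity_decompose[of n p] m p assms unfolding Q_def
    by (metis One_nat_def not_one_le_zero nonzero_mult_div_cancel_left mult_eq_0_iff not_prime_unit)
  then have "p' \<noteq> p" using p' by auto
  moreover have "p' dvd n" using m p' by simp
  ultimately have nonempty: "pverts ?\<Gamma> \<noteq> {}"
    using in_arcsD1[OF hubs_adjacent[of p p']] p p' by blast
  \<comment> \<open>The walk visits a hub adjacent to \<open>u\<close>, then a hub adjacent to
    \<open>v\<close>.\<close>
  have "u \<rightarrow>\<^sup>*\<^bsub>with_proj ?\<Gamma>\<^esub> v" if uv: "u \<in> pverts ?\<Gamma>" "v \<in> pverts ?\<Gamma>" for u v
  proof -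
    obtain q where q: "prime q" "q dvd n" "(u, hub q) \<in> parcs ?\<Gamma>" using adjacent_hub uv by blast
    obtain q' where q': "prime q'" "q' dvd n" "(v, hub q') \<in> parcs ?\<Gamma>" using adjacent_hub uv by blast
    have "hub q \<rightarrow>\<^sup>*\<^bsub>with_proj ?\<Gamma>\<^esub> hub q'"
    proof (cases "q = q'")
      case True
      \<comment> \<open>The trivial walk requires \<open>hub q\<close> to be a vertex, which it is
        as the end of an arc.\<close>
      then show ?thesis using q by (auto dest: in_arcsD2)
    next
      case False
      then show ?thesis using hubs_adjacent q q' by (intro reachable_adjI) simp
    qed
    moreover have "u \<rightarrow>\<^sup>*\<^bsub>with_proj ?\<Gamma>\<^esub> hub q" using q by (intro reachable_adjI) simp
    moreover have "hub q' \<rightarrow>\<^sup>*\<^bsub>with_proj ?\<Gamma>\<^esub> v" using q' sym by (intro reachable_adjI) simp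
    ultimately show ?thesis by (meson reachable_trans)
  qed
  \<comment> \<open>Connectedness is strong connectedness of the symmetric closure, where
    reachability persists.\<close>
  with nonempty show "Digraph_Component.connected (with_proj ?\<Gamma>)"
    unfolding connected_def strongly_connected_def by (auto intro: reachable_mk_symmetricI)
qed

end
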